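(* Let $d\ge 1$ be an integer and let $(\pi,T_0,T_1)$ be a $d$-dimensional classical discrete-time counting process, with arbitrary initial distribution $\pi$ and arbitrary tick transition matrix $T_1$, that eventually ticks (i.e. the first tick occurs with probability one). Let $\mu$ and $\sigma^2$ be the mean and the variance of its first-tick time. Then $$d\,\sigma^2\;\ge\;\mu(\mu-d).$$
   Context: A $d$-dimensional classical discrete-time counting process is a triple $(\pi,T_0,T_1)$, where $\pi\in\mathbb{R}^d$ is a probability row vector (nonnegative entries summing to $1$), and $T_0,T_1$ are $d\times d$ real matrices with nonnegative entries such that $T_0+T_1$ is right-stochastic, i.e. $(T_0+T_1)\eta=\eta$ with $\eta=(1,\dots,1)^{\mathsf T}$. The matrix $T_0$ describes a step without a tick and $T_1$ a step with a tick. The first-tick time is the random variable with values in $\{1,2,\dots\}$ and distribution $$p_L=\pi\,T_0^{L-1}T_1\eta=\pi\,T_0^{L-1}(\mathbb{1}-T_0)\eta,\qquad L\ge 1.$$ The process eventually ticks if $\sum_{L\ge1}p_L=1$; equivalently, the restriction of $T_0$ to the set of internal states reachable from the support of $\pi$ before the first tick has spectral radius strictly less than $1$ (in particular all moments of the first-tick time are then finite). The mean and variance are $$\mu=\sum_{L\ge1}L\,p_L,\qquad \sigma^2=\sum_{L\ge1}(L-\mu)^2p_L .$$ *)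

theory Defs
  imports "HOL-Analysis.Analysis"
begin

text \<open>
  On \<open>real^'n^'n\<close> the operations \<open>*\<close> and \<open>^\<close> act componentwise, hence a separate power for
  the matrix product \<open>**\<close>. Note that \<open>1 :: real^'n\<close> is the all-ones vector
  \<open>\<eta> = (1,\<dots>,1)\<close>.
\<close>

primrec matrix_power :: "real^'n^'n \<Rightarrow> nat \<Rightarrow> real^'n^'n" where
  "matrix_power A 0 = mat 1"
| "matrix_power A (Suc k) = A ** matrix_power A k"

definition probability_vector :: "real^'n \<Rightarrow> bool" where
  "probability_vector v \<longleftrightarrow> (\<forall>i. 0 \<le> v $ i) \<and> (\<Sum>i\<in>UNIV. v $ i) = 1"

definition nonneg_matrix :: "real^'n^'n \<Rightarrow> bool" where
  "nonneg_matrix A \<longleftrightarrow> (\<forall>i j. 0 \<le> A $ i $ j)"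

definition counting_process :: "real^'n \<Rightarrow> real^'n^'n \<Rightarrow> real^'n^'n \<Rightarrow> bool" where
  "counting_process \<pi> T0 T1 \<longleftrightarrow>
     probability_vector \<pi> \<and> nonneg_matrix T0 \<and> nonneg_matrix T1 \<and> (T0 + T1) *v 1 = 1"

text \<open>
  The row vector \<open>\<pi>\<close> acts from the left (\<open>v*\<close>); the pairing of a row with a column vector
  is the inner product. The value at \<open>L = 0\<close> is meaningless and never used: all sums below range
  over \<open>L \<ge> 1\<close>.
\<close>

definition first_tick_prob :: "real^'n \<Rightarrow> real^'n^'n \<Rightarrow> real^'n^'n \<Rightarrow> nat \<Rightarrow> real" where
  "first_tick_prob \<pi> T0 T1 L = (\<pi> v* matrix_power T0 (L - 1)) \<bullet> (T1 *v 1)"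

definition eventually_ticks :: "real^'n \<Rightarrow> real^'n^'n \<Rightarrow> real^'n^'n \<Rightarrow> bool" where
  "eventually_ticks \<pi> T0 T1 \<longleftrightarrow> (first_tick_prob \<pi> T0 T1 has_sum 1) {1..}"

text \<open>
  For a counting process that eventually ticks, the first-tick distribution has a geometric tail,
  so both of the following sums converge.
\<close>

definition tick_mean :: "real^'n \<Rightarrow> real^'n^'n \<Rightarrow> real^'n^'n \<Rightarrow> real" where
  "tick_mean \<pi> T0 T1 = (\<Sum>\<^sub>\<infinity>L\<in>{1..}. real L * first_tick_prob \<pi> T0 T1 L)"

definition tick_variance :: "real^'n \<Rightarrow> real^'n^'n \<Rightarrow> real^'n^'n \<Rightarrow> real" where
  "tick_variance \<pi> T0 T1 =
     (\<Sum>\<^sub>\<infinity>L\<in>{1..}. (real L - tick_mean \<pi> T0 T1)\<^sup>2 * first_tick_prob \<pi> T0 T1 L)"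

end

theory Submission
  imports Defs
begin

text \<open>
  Let \<open>h i\<close> be the expected time to the first tick from state \<open>i\<close>, with value \<open>0\<close> after the tick.
  Since \<open>h (X\<^sub>n) + n\<close> is a martingale, \<open>\<sigma>\<^sup>2 + \<mu>\<close> is the variance of \<open>h (X\<^sub>0)\<close> plus the expected sum
  of the squared jumps of \<open>h\<close> along the path. As in the Aldous--Shepp theorem, a path
  descends from \<open>h i\<close> to \<open>0\<close> through a set of at most \<open>d\<close> positive values, so the
  squared jumps sum to at least \<open>(h i)\<^sup>2 / d\<close> by Cauchy--Schwarz; averaging over \<open>i\<close> and Jensen's
  inequality give the bound. Instead of path-space arguments we use a potential \<open>\<psi> \<ge> x\<^sup>2 / d\<close> with
  \<open>\<psi> x \<le> (x - y)\<^sup>2 + \<psi> y\<close>: if \<open>m\<close> is the second moment, then \<open>m - h\<^sup>2 + h - \<psi> \<circ> h\<close> is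
  superharmonic for a transient matrix, hence nonnegative.
\<close>

section \<open>Potential for squared jumps on a finite set of reals\<close>

text \<open>\<open>\<psi> x\<close> is the cost of descending from \<open>x\<close> to \<open>0\<close> through all intermediate values in \<open>S\<close>,
  a jump costing the square of its size. Monotonicity is carried along for the induction.\<close>

lemma square_cost_potential:
  fixes S :: "real set"
  assumes "finite S" "\<forall>x\<in>S. 0 < x"
  shows "\<exists>\<psi>::real \<Rightarrow> real. \<psi> 0 = 0 \<and> mono_on (insert 0 S) \<psi> \<and>
    (\<forall>x\<in>insert 0 S. \<forall>y\<in>insert 0 S. \<psi> x \<le> (x - y)\<^sup>2 + \<psi> y) \<and>
    (\<forall>x\<in>S. x\<^sup>2 \<le> real (card S) * \<psi> x)"
  using assms
proof (induction S rule: finite_linorder_max_induct)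
  case empty
  show ?case by (intro exI[of _ "\<lambda>_. 0"]) (auto simp: mono_on_def)
next
  case (insert b S)
  then obtain \<psi> :: "real \<Rightarrow> real" where \<psi>0: "\<psi> 0 = 0" and mono: "mono_on (insert 0 S) \<psi>"
    and step: "\<And>x y. x \<in> insert 0 S \<Longrightarrow> y \<in> insert 0 S \<Longrightarrow> \<psi> x \<le> (x - y)\<^sup>2 + \<psi> y"
    and lower: "\<And>x. x \<in> S \<Longrightarrow> x\<^sup>2 \<le> real (card S) * \<psi> x"
    by (metis insertCI)
  have "0 < b" "b \<notin> S" using insert by auto
  define m where "m = Max (insert 0 S)"
  have m: "m \<in> insert 0 S" and m_max: "\<And>x. x \<in> insert 0 S \<Longrightarrow> x \<le> m"
    unfolding m_def using \<open>finite S\<close> by (intro Max_in Max_ge; simp)+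
  have "m < b" "0 \<le> m" using m m_max \<open>0 < b\<close> insert by auto
  have nonneg: "0 \<le> \<psi> x" if "x \<in> insert 0 S" for x
    using mono_onD[OF mono, of 0 x] that \<psi>0 insert.prems by force
  \<comment> \<open>The new largest value \<open>b\<close> descends through the previous maximum
    \<open>m\<close>, which is \<open>0\<close> if \<open>S\<close> is empty.\<close>
  define \<phi> where "\<phi> = \<psi>(b := \<psi> m + (b - m)\<^sup>2)"
  have \<phi>b: "\<phi> b = \<psi> m + (b - m)\<^sup>2" and \<phi>S: "\<And>x. x \<in> insert 0 S \<Longrightarrow> \<phi> x = \<psi> x"
    using \<open>b \<notin> S\<close> \<open>0 < b\<close> by (auto simp: \<phi>_def)
  \<comment> \<open>Monotonicity is needed here: it makes an upward jump to \<open>b\<close>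
    harmless.\<close>
  have le_b: "\<psi> x \<le> \<phi> b" if "x \<in> insert 0 S" for x
    using mono_onD[OF mono that m m_max[OF that]] by (simp add: \<phi>b add_increasing2)
  have lt_b: "x < b" if "x \<in> insert 0 S" for x
    using m_max[OF that] \<open>m < b\<close> by simp
  have "mono_on (insert 0 (insert b S)) \<phi>"
  proof (rule mono_onI)
    fix x y assume xy: "x \<in> insert 0 (insert b S)" "y \<in> insert 0 (insert b S)" "x \<le> y"
    show "\<phi> x \<le> \<phi> y"
    proof (cases "x = b \<or> y = b")
      case True
      then show ?thesis using xy lt_b le_b \<phi>S \<open>b \<notin> S\<close>
        by (metis insertCI insertE leD order_refl)
    next
      case False
      then have "x \<in> insert 0 S" "y \<in> insert 0 S" using xy by auto
      then show ?thesis using mono_onD[OF mono _ _ xy(3)] \<phi>S by simp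
    qed
  qed
  moreover have "\<phi> x \<le> (x - y)\<^sup>2 + \<phi> y"
    if xy: "x \<in> insert 0 (insert b S)" "y \<in> insert 0 (insert b S)" for x y
  proof -
    consider "x = b" "y = b" | "x \<in> insert 0 S" "y \<in> insert 0 S" | "x \<in> insert 0 S" "y = b"
      | "x = b" "y \<in> insert 0 S" using xy by auto
    then show ?thesis
    proof cases
      \<comment> \<open>Stopping at \<open>m\<close> on the way from \<open>b\<close> down to
        \<open>y\<close> does not raise the cost, since the square is superadditive on nonnegative
        lengths.\<close>
      case 4
      have "0 \<le> (m - y) * (b - m)" using m_max[OF 4(2)] \<open>m < b\<close> by simp
      then have "(m - y)\<^sup>2 + (b - m)\<^sup>2 \<le> (b - y)\<^sup>2" by (simp add: power2_eq_square algebra_simps)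
      then show ?thesis using step[OF m 4(2)] 4 \<phi>b \<phi>S[OF 4(2)] by simp
    qed (use step \<phi>S le_b in \<open>auto simp: add_increasing\<close>)
  qed
  moreover have "x\<^sup>2 \<le> real (card (insert b S)) * \<phi> x" if "x \<in> insert b S" for x
  proof (cases "x = b")
    case False
    then have "x \<in> S" using that by simp
    then have "x\<^sup>2 \<le> real (card S) * \<psi> x" "0 \<le> \<psi> x" using lower nonneg by auto
    then show ?thesis using \<phi>S[of x] \<open>x \<in> S\<close> \<open>finite S\<close> \<open>b \<notin> S\<close> by (simp add: algebra_simps)
  next
    case True
    let ?n = "real (card S)"
    have m2: "m\<^sup>2 \<le> ?n * \<psi> m" using m lower \<psi>0 by auto
    show ?thesis
    proof (cases "S = {}")
      case True
      then show ?thesis using \<open>x = b\<close> \<phi>b m \<psi>0 by simp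
    next
      case False
      then have n: "?n > 0" using \<open>finite S\<close> by (simp add: card_gt_0_iff)
      \<comment> \<open>Cauchy--Schwarz for the splitting \<open>b = m + (b - m)\<close>: this
        square is exactly the gap in the next inequality, and vanishes when \<open>b - m\<close> is
        the average \<open>m / n\<close> of the earlier jumps.\<close>
      have "0 \<le> (m - ?n * (b - m))\<^sup>2" by simp
      then have "?n * b\<^sup>2 \<le> (?n + 1) * (m\<^sup>2 + ?n * (b - m)\<^sup>2)"
        by (simp add: power2_eq_square algebra_simps)
      also have "\<dots> \<le> (?n + 1) * (?n * \<psi> m + ?n * (b - m)\<^sup>2)"
        using m2 by (intro mult_left_mono) auto
      also have "\<dots> = ?n * ((?n + 1) * \<phi> b)" by (simp add: \<phi>b algebra_simps)
      finally have "b\<^sup>2 \<le> (?n + 1) * \<phi> b" using n by simp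
      then show ?thesis using \<open>x = b\<close> \<open>finite S\<close> \<open>b \<notin> S\<close> by (simp add: add.commute)
    qed
  qed
  moreover have "\<phi> 0 = 0" using \<phi>S \<psi>0 by simp
  ultimately show ?case by (intro exI[of _ \<phi>] conjI ballI)
qed

section \<open>Powers of nonnegative matrices\<close>

lemma matrix_vector_mult_minus:
  fixes A :: "'a::ring_1^'n^'m"
  shows "A *v (- x) = - (A *v x)"
  by (vector matrix_vector_mult_def sum_negf)

lemma matrix_power_vector_Suc:
  "matrix_power A (Suc n) *v x = A *v (matrix_power A n *v x)"
  by (simp add: matrix_vector_mul_assoc)

lemma matrix_power_commute: "matrix_power A n ** A = A ** matrix_power A n"
  by (induction n) (simp_all flip: matrix_mul_assoc)

lemma matrix_power_vector_Suc':
  "matrix_power A (Suc n) *v x = matrix_power A n *v (A *v x)"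
  by (simp add: matrix_vector_mul_assoc matrix_power_commute)

lemma nonneg_matrix_mono:
  assumes "nonneg_matrix A" "x \<le> y"
  shows "A *v x \<le> A *v y"
  using assms unfolding nonneg_matrix_def less_eq_vec_def matrix_vector_mult_def
  by (auto intro!: sum_mono mult_left_mono)

lemma nonneg_matrix_power:
  assumes "nonneg_matrix A"
  shows "nonneg_matrix (matrix_power A n)"
proof (induction n)
  case 0
  show ?case by (simp add: nonneg_matrix_def mat_def)
next
  case (Suc n)
  then show ?case using assms
    by (auto simp: nonneg_matrix_def matrix_matrix_mult_def intro!: sum_nonneg)
qed

section \<open>Transient substochastic matrices\<close>

locale transient_matrix =
  fixes A :: "real^'n^'n"
  assumes nonneg: "nonneg_matrix A"
    and substochastic: "A *v 1 \<le> 1"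
    and transient: "(\<lambda>n. matrix_power A n *v 1) \<longlonglongrightarrow> 0"
begin

lemmas pow_mono = nonneg_matrix_mono[OF nonneg_matrix_power[OF nonneg]]

lemma power_abs_le:
  "\<bar>(matrix_power A n *v x) $ i\<bar> \<le> norm x * (matrix_power A n *v 1) $ i"
proof -
  have "x \<le> norm x *\<^sub>R 1" "- x \<le> norm x *\<^sub>R 1"
    using component_le_norm_cart[of x] by (auto simp: less_eq_vec_def abs_le_iff minus_le_iff)
  from this[THEN pow_mono, of n] show ?thesis
    by (simp add: less_eq_vec_def matrix_vector_mult_scaleR matrix_vector_mult_minus abs_le_iff)
qed

lemma power_tendsto_0: "(\<lambda>n. matrix_power A n *v x) \<longlonglongrightarrow> 0"
proof (rule vec_tendstoI)
  fix i
  have "(\<lambda>n. norm x * (matrix_power A n *v 1) $ i) \<longlonglongrightarrow> norm x * (0 :: real^'n) $ i"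
    by (intro tendsto_intros transient)
  then have "(\<lambda>n. norm x * (matrix_power A n *v 1) $ i) \<longlonglongrightarrow> 0" by simp
  then show "(\<lambda>n. (matrix_power A n *v x) $ i) \<longlonglongrightarrow> (0 :: real^'n) $ i"
    unfolding zero_index by (rule Lim_null_comparison[OF always_eventually, rotated])
      (simp add: power_abs_le)
qed

text \<open>A fixed vector of \<open>A\<close> is fixed by all powers, which tend to zero, so
  \<open>mat 1 - A\<close> is injective and hence invertible. This supplies the moment vectors
  without summing a Neumann series.\<close>

lemma solve: obtains y where "y = x + A *v y"
proof -
  have "z = 0" if "(mat 1 - A) *v z = 0" for z
  proof -
    have "A *v z = z" using that by (simp add: matrix_vector_mult_diff_rdistrib)
    then have "matrix_power A n *v z = z" for n
      by (induction n) (simp_all add: matrix_power_vector_Suc del: matrix_power.simps(2))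
    then have "(\<lambda>n. z) \<longlonglongrightarrow> 0" using power_tendsto_0[of z] by presburger
    then show "z = 0" by (simp only: LIMSEQ_const_iff)
  qed
  then obtain B where "B ** (mat 1 - A) = mat 1"
    using matrix_left_invertible_ker[of "mat 1 - A"] by blast
  then have "(mat 1 - A) ** B = mat 1" by (simp only: matrix_left_right_inverse)
  then have "(mat 1 - A) *v (B *v x) = x"
    by (simp add: matrix_vector_mul_assoc)
  then have "B *v x = x + A *v (B *v x)"
    by (simp only: matrix_vector_mult_diff_rdistrib matrix_vector_mul_lid diff_eq_eq)
  then show ?thesis by (rule that)
qed

text \<open>Minimum principle: by iteration every \<open>matrix_power A n *v u\<close> lies below
  \<open>u\<close>, and these vectors tend to zero.\<close>

lemma superharmonic_nonneg:
  assumes "A *v u \<le> u"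
  shows "0 \<le> u"
proof -
  have le: "matrix_power A n *v u \<le> u" for n
  proof (induction n)
    case (Suc n)
    have "matrix_power A (Suc n) *v u \<le> matrix_power A n *v u"
      unfolding matrix_power_vector_Suc' using pow_mono[OF assms] .
    then show ?case using Suc by simp
  qed simp
  show ?thesis unfolding less_eq_vec_def
  proof
    fix i
    show "0 $ i \<le> u $ i"
      using LIMSEQ_le_const2[OF tendsto_vec_nth[OF power_tendsto_0[of u], of i]] le
      by (auto simp: less_eq_vec_def)
  qed
qed

text \<open>The solution of \<open>h = 1 + A h\<close> satisfies \<open>A h = h - 1 \<le> (1 - 1 / H) h\<close> for any bound \<open>H\<close>
  of \<open>h\<close>, which gives the geometric rate.\<close>

lemma power_geometric:
  obtains \<rho> :: real where "0 \<le> \<rho>" "\<rho> < 1"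
    "\<And>x. \<exists>C. \<forall>n. norm (matrix_power A n *v x) \<le> C * \<rho> ^ n"
proof -
  obtain h where h: "h = 1 + A *v h" by (rule solve)
  have "A *v h \<le> h" by (subst (2) h) (simp add: less_eq_vec_def)
  then have "0 \<le> A *v h"
    using nonneg_matrix_mono[OF nonneg] superharmonic_nonneg by fastforce
  then have h1: "1 \<le> h $ i" for i using h
    by (metis add_increasing2 less_eq_vec_def one_index order_refl vector_add_component zero_index)
  define H where "H = norm h"
  define \<rho> where "\<rho> = 1 - 1 / H"
  have hH: "h $ i \<le> H" for i
    using component_le_norm_cart[of h i] unfolding H_def by linarith
  then have "1 \<le> H" using h1 order_trans by blast
  then have \<rho>: "0 \<le> \<rho>" "\<rho> < 1" by (auto simp: \<rho>_def)
  have "A *v h = h - 1" using h by (metis add_diff_cancel_left')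
  moreover have "(h - 1) $ i \<le> (\<rho> *\<^sub>R h) $ i" for i
    using hH[of i] \<open>1 \<le> H\<close> by (simp add: \<rho>_def field_simps)
  ultimately have Ah: "A *v h \<le> \<rho> *\<^sub>R h" by (simp add: less_eq_vec_def)
  have ph: "matrix_power A n *v h \<le> \<rho> ^ n *\<^sub>R h" for n
  proof (induction n)
    case (Suc n)
    have "matrix_power A (Suc n) *v h \<le> A *v (\<rho> ^ n *\<^sub>R h)"
      unfolding matrix_power_vector_Suc using nonneg_matrix_mono[OF nonneg Suc] .
    also have "\<dots> = \<rho> ^ n *\<^sub>R (A *v h)" by (simp add: matrix_vector_mult_scaleR)
    also have "\<dots> \<le> \<rho> ^ n *\<^sub>R (\<rho> *\<^sub>R h)"
      using Ah \<rho> by (auto simp: less_eq_vec_def mult.assoc intro!: mult_left_mono)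
    finally show ?case by (simp add: mult.commute)
  qed simp
  have "norm (matrix_power A n *v x) \<le> (\<Sum>i\<in>UNIV. norm x * h $ i) * \<rho> ^ n" for n x
  proof -
    \<comment> \<open>The decay of \<open>h\<close> passes to the all-ones vector, which dominates
      every \<open>x\<close> up to its norm.\<close>
    have "1 \<le> h" using h1 by (simp add: less_eq_vec_def)
    then have "matrix_power A n *v 1 \<le> \<rho> ^ n *\<^sub>R h"
      using pow_mono ph order_trans by blast
    then have "norm x * (matrix_power A n *v 1) $ i \<le> norm x * (\<rho> ^ n * h $ i)" for i
      by (intro mult_left_mono) (auto simp: less_eq_vec_def)
    then have "\<bar>(matrix_power A n *v x) $ i\<bar> \<le> norm x * h $ i * \<rho> ^ n" for i
      using power_abs_le[of n x i] by (simp add: mult_ac) (meson order_trans)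
    then show ?thesis
      unfolding sum_distrib_right by (intro order_trans[OF norm_le_l1_cart] sum_mono)
  qed
  then show ?thesis using that[OF \<rho>] by blast
qed

text \<open>Makes the remainders of the partial moment sums vanish.\<close>

lemma poly_times_power_tendsto_0:
  "(\<lambda>n. real n ^ 2 * (v \<bullet> (matrix_power A n *v x))) \<longlonglongrightarrow> 0"
  "(\<lambda>n. real n * (v \<bullet> (matrix_power A n *v x))) \<longlonglongrightarrow> 0"
proof -
  obtain \<rho> C where \<rho>: "0 \<le> \<rho>" "\<rho> < 1" and C: "\<And>n. norm (matrix_power A n *v x) \<le> C * \<rho> ^ n"
    by (metis power_geometric)
  \<comment> \<open>With this square root, \<open>n^2 * \<rho>^n\<close> is the square of
    \<open>n * r^n\<close>.\<close>
  define r where "r = sqrt \<rho>"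
  have r: "0 \<le> r" "r < 1" "\<rho> = r * r" using \<rho> by (auto simp: r_def)
  have bound: "norm (v \<bullet> (matrix_power A n *v x)) \<le> norm v * C * (r ^ n * r ^ n)" for n
  proof -
    have "norm (v \<bullet> (matrix_power A n *v x)) \<le> norm v * norm (matrix_power A n *v x)"
      by (simp add: Cauchy_Schwarz_ineq2)
    also have "\<dots> \<le> norm v * (C * \<rho> ^ n)" by (intro mult_left_mono C) auto
    finally show ?thesis by (simp add: r power_mult_distrib mult_ac)
  qed
  have lim: "(\<lambda>n. real n * r ^ n) \<longlonglongrightarrow> 0"
    using powser_times_n_limit_0[of r] r by simp
  have "(\<lambda>n. norm v * C * ((real n * r ^ n) * (real n * r ^ n))) \<longlonglongrightarrow> norm v * C * (0 * 0)"
    by (intro tendsto_intros lim)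
  then have lim2: "(\<lambda>n. norm v * C * ((real n * r ^ n) * (real n * r ^ n))) \<longlonglongrightarrow> 0" by simp
  have bound2: "norm (real n ^ 2 * (v \<bullet> (matrix_power A n *v x)))
      \<le> norm v * C * ((real n * r ^ n) * (real n * r ^ n))" for n
  proof -
    have "norm (real n ^ 2 * (v \<bullet> (matrix_power A n *v x)))
        = real n ^ 2 * norm (v \<bullet> (matrix_power A n *v x))"
      by (simp add: abs_mult)
    also have "\<dots> \<le> real n ^ 2 * (norm v * C * (r ^ n * r ^ n))"
      by (intro mult_left_mono bound) auto
    finally show ?thesis by (simp add: power2_eq_square mult_ac)
  qed
  show "(\<lambda>n. real n ^ 2 * (v \<bullet> (matrix_power A n *v x))) \<longlonglongrightarrow> 0"
    by (rule Lim_null_comparison[OF always_eventually lim2]) (use bound2 in blast)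
  have "norm (real n * (v \<bullet> (matrix_power A n *v x)))
      \<le> norm (real n ^ 2 * (v \<bullet> (matrix_power A n *v x)))" for n
    unfolding norm_mult by (rule mult_right_mono) (simp_all add: power2_eq_square flip: of_nat_mult)
  then show "(\<lambda>n. real n * (v \<bullet> (matrix_power A n *v x))) \<longlonglongrightarrow> 0"
    by (intro Lim_null_comparison[OF always_eventually lim2] allI order_trans[OF _ bound2])
qed

lemma inner_power_tendsto_0: "(\<lambda>n. v \<bullet> (matrix_power A n *v x)) \<longlonglongrightarrow> 0"
  using tendsto_inner[OF tendsto_const power_tendsto_0] by simp

end

section \<open>Moments of the absorption time\<close>

locale absorbed_process = transient_matrix A for A :: "real^'n^'n" +
  fixes \<pi> :: "real^'n"
  assumes initial: "probability_vector \<pi>"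
begin

definition survival :: "nat \<Rightarrow> real" where
  "survival n = \<pi> \<bullet> (matrix_power A n *v 1)"

text \<open>The index is shifted by one: this is the probability of absorption at time
  \<open>Suc n\<close>.\<close>

definition hitting_prob :: "nat \<Rightarrow> real" where
  "hitting_prob n = survival n - survival (Suc n)"

lemma initial_mono: "x \<le> y \<Longrightarrow> \<pi> \<bullet> x \<le> \<pi> \<bullet> y"
  using initial unfolding probability_vector_def less_eq_vec_def inner_vec_def
  by (auto intro!: sum_mono mult_left_mono)

lemma hitting_prob_nonneg: "0 \<le> hitting_prob n"
  unfolding hitting_prob_def survival_def matrix_power_vector_Suc'
  using initial_mono[OF pow_mono[OF substochastic]] by simp

lemma initial_one: "\<pi> \<bullet> 1 = 1"
  using initial by (simp add: probability_vector_def inner_vec_def)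

lemma hitting_prob_sums: "hitting_prob sums 1"
proof -
  have "survival \<longlonglongrightarrow> 0"
    unfolding survival_def by (rule inner_power_tendsto_0)
  then show ?thesis
    using telescope_sums'[of survival 0]
    by (simp add: hitting_prob_def[abs_def]) (simp add: survival_def initial_one)
qed

text \<open>Below, \<open>h\<close> and \<open>m\<close> are the vectors of first and second moments of the absorption time,
  indexed by the starting state; their equations come from conditioning on the first step.\<close>

lemma first_moment_sums:
  assumes h: "h = 1 + A *v h"
  shows "(\<lambda>n. real (Suc n) * hitting_prob n) sums (\<pi> \<bullet> h)"
proof -
  let ?b = "\<lambda>x n. \<pi> \<bullet> (matrix_power A n *v x)"
  have b_h: "?b h n = ?b 1 n + ?b h (Suc n)" for n
    unfolding matrix_power_vector_Suc'
    by (subst (1) h) (simp only: matrix_vector_right_distrib inner_add_right)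
  \<comment> \<open>Summation by parts in closed form; the subtracted remainder tends to
    zero.\<close>
  have partial: "(\<Sum>n<N. real (Suc n) * hitting_prob n) = \<pi> \<bullet> h - (?b h N + real N * ?b 1 N)" for N
  proof (induction N)
    case (Suc N)
    then show ?case
      unfolding sum.lessThan_Suc hitting_prob_def survival_def of_nat_Suc b_h[of N] by algebra
  qed simp
  have "(\<lambda>N. \<pi> \<bullet> h - (?b h N + real N * ?b 1 N)) \<longlonglongrightarrow> \<pi> \<bullet> h - (0 + 0)"
    by (intro tendsto_diff tendsto_add tendsto_mult_left tendsto_const inner_power_tendsto_0
        poly_times_power_tendsto_0)
  then show ?thesis unfolding sums_def partial by simp
qed

text \<open>The equation for \<open>m\<close> is \<open>(1 + T)^2 = 1 + 2 T + T^2\<close> in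
  expectation, with \<open>T\<close> the time left after the first step and \<open>T = 0\<close> on
  absorption.\<close>

lemma second_moment_sums:
  assumes h: "h = 1 + A *v h" and m: "m = (1 + 2 *\<^sub>R (A *v h)) + A *v m"
  shows "(\<lambda>n. (real (Suc n))\<^sup>2 * hitting_prob n) sums (\<pi> \<bullet> m)"
proof -
  let ?b = "\<lambda>x n. \<pi> \<bullet> (matrix_power A n *v x)"
  have b_h: "?b h n = ?b 1 n + ?b h (Suc n)" for n
    unfolding matrix_power_vector_Suc'
    by (subst (1) h) (simp only: matrix_vector_right_distrib inner_add_right)
  have b_m: "?b m n = ?b 1 n + 2 * ?b h (Suc n) + ?b m (Suc n)" for n
    unfolding matrix_power_vector_Suc'
    by (subst (1) m) (simp only: matrix_vector_right_distrib matrix_vector_mult_scaleR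
        inner_add_right inner_scaleR_right)
  have partial: "(\<Sum>n<N. (real (Suc n))\<^sup>2 * hitting_prob n) =
      \<pi> \<bullet> m - (?b m N + 2 * (real N * ?b h N) + (real N)\<^sup>2 * ?b 1 N)" for N
  proof (induction N)
    case (Suc N)
    then show ?case
      unfolding sum.lessThan_Suc hitting_prob_def survival_def of_nat_Suc b_h[of N] b_m[of N]
      by algebra
  qed simp
  have "(\<lambda>N. \<pi> \<bullet> m - (?b m N + 2 * (real N * ?b h N) + (real N)\<^sup>2 * ?b 1 N))
      \<longlonglongrightarrow> \<pi> \<bullet> m - (0 + 2 * 0 + 0)"
    by (intro tendsto_diff tendsto_add tendsto_mult_left tendsto_const inner_power_tendsto_0
        poly_times_power_tendsto_0)
  then show ?thesis unfolding sums_def partial by simp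
qed

text \<open>The last factor is variance plus mean of the absorption time from \<open>i\<close>, that
  is, the expected sum of squared jumps of \<open>h\<close>. The potential bounds it below by
  \<open>(h $ i)^2\<close> over the number of distinct values of \<open>h\<close>.\<close>

lemma second_moment_lower_bound:
  assumes h: "h = 1 + A *v h" and m: "m = (1 + 2 *\<^sub>R (A *v h)) + A *v m"
  shows "(h $ i)\<^sup>2 \<le> real CARD('n) * (m $ i - (h $ i)\<^sup>2 + h $ i)"
proof -
  have "0 \<le> h"
  proof (rule superharmonic_nonneg)
    show "A *v h \<le> h" by (subst (2) h) (simp add: less_eq_vec_def)
  qed
  then have Ah0: "0 \<le> A *v h" using nonneg_matrix_mono[OF nonneg] by fastforce
  have h_pos: "0 < h $ i" for i
  proof -
    have "h $ i = 1 + (A *v h) $ i" by (subst (1) h) simp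
    moreover have "0 \<le> (A *v h) $ i" using Ah0 by (simp add: less_eq_vec_def)
    ultimately show ?thesis by linarith
  qed
  let ?S = "range (($) h)"
  obtain \<psi> :: "real \<Rightarrow> real" where \<psi>0: "\<psi> 0 = 0"
    and step: "\<And>x y. x \<in> insert 0 ?S \<Longrightarrow> y \<in> insert 0 ?S \<Longrightarrow> \<psi> x \<le> (x - y)\<^sup>2 + \<psi> y"
    and lower: "\<And>x. x \<in> ?S \<Longrightarrow> x\<^sup>2 \<le> real (card ?S) * \<psi> x"
  proof -
    have "finite ?S" "\<forall>x\<in>?S. 0 < x" using h_pos by auto
    from square_cost_potential[OF this] show thesis
      by (elim exE conjE) (rule that, assumption, blast+)
  qed
  define u where "u = (\<chi> i. m $ i - (h $ i)\<^sup>2 + h $ i - \<psi> (h $ i))"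
  have "(A *v u) $ i \<le> u $ i" for i
  proof -
    let ?a = "\<lambda>j. A $ i $ j"
    have a0: "0 \<le> ?a j" for j using nonneg by (simp add: nonneg_matrix_def)
    have a1: "(\<Sum>j\<in>UNIV. ?a j) \<le> 1"
      using substochastic by (simp add: less_eq_vec_def matrix_vector_mult_def)
    have Eh: "h $ i = 1 + (\<Sum>j\<in>UNIV. ?a j * h $ j)"
      by (subst (1) h) (simp add: matrix_vector_mult_def)
    have Em: "m $ i = 1 + 2 * (\<Sum>j\<in>UNIV. ?a j * h $ j) + (\<Sum>j\<in>UNIV. ?a j * m $ j)"
      by (subst (1) m) (simp add: matrix_vector_mult_def)
    \<comment> \<open>The potential inequality is averaged over the next step: first the moves to a
      state \<open>j\<close>, then absorption, a jump to \<open>0\<close> with the missing row mass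
      as its probability.\<close>
    have "(\<Sum>j\<in>UNIV. ?a j) * \<psi> (h $ i) \<le> (\<Sum>j\<in>UNIV. ?a j * ((h $ i - h $ j)\<^sup>2 + \<psi> (h $ j)))"
      unfolding sum_distrib_right by (intro sum_mono mult_left_mono a0 step) auto
    moreover have "(1 - (\<Sum>j\<in>UNIV. ?a j)) * \<psi> (h $ i) \<le> (1 - (\<Sum>j\<in>UNIV. ?a j)) * (h $ i)\<^sup>2"
      using step[of "h $ i" 0] \<psi>0 a1 by (intro mult_left_mono) auto
    moreover have "(\<Sum>j\<in>UNIV. ?a j * ((h $ i - h $ j)\<^sup>2 + \<psi> (h $ j))) =
        (\<Sum>j\<in>UNIV. ?a j) * (h $ i)\<^sup>2 - 2 * h $ i * (\<Sum>j\<in>UNIV. ?a j * h $ j)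
        + (\<Sum>j\<in>UNIV. ?a j * (h $ j)\<^sup>2) + (\<Sum>j\<in>UNIV. ?a j * \<psi> (h $ j))"
      by (simp add: power2_eq_square algebra_simps sum.distrib sum_subtractf sum_distrib_left
          sum_distrib_right)
    moreover have "(\<Sum>j\<in>UNIV. ?a j * h $ j) = h $ i - 1" using Eh by linarith
    ultimately have ineq: "\<psi> (h $ i) \<le> (h $ i)\<^sup>2 - 2 * h $ i * (h $ i - 1)
        + (\<Sum>j\<in>UNIV. ?a j * (h $ j)\<^sup>2) + (\<Sum>j\<in>UNIV. ?a j * \<psi> (h $ j))"
      by (simp only: left_diff_distrib mult_1)
    have "(A *v u) $ i = (\<Sum>j\<in>UNIV. ?a j * m $ j) - (\<Sum>j\<in>UNIV. ?a j * (h $ j)\<^sup>2)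
        + (\<Sum>j\<in>UNIV. ?a j * h $ j) - (\<Sum>j\<in>UNIV. ?a j * \<psi> (h $ j))"
      by (simp add: u_def matrix_vector_mult_def algebra_simps sum.distrib sum_subtractf)
    then show ?thesis using ineq Eh Em by (simp add: u_def power2_eq_square algebra_simps)
  qed
  then have "0 \<le> u" by (intro superharmonic_nonneg) (simp add: less_eq_vec_def)
  then have psi_le: "\<psi> (h $ i) \<le> m $ i - (h $ i)\<^sup>2 + h $ i"
    by (simp add: u_def less_eq_vec_def algebra_simps)
  \<comment> \<open>The sign of \<open>\<psi> (h $ i)\<close> is needed to replace the number of
    distinct values of \<open>h\<close> by the dimension.\<close>
  have "0 < (h $ i)\<^sup>2" using h_pos[of i] by simp
  then have "0 \<le> \<psi> (h $ i)" using lower[of "h $ i"]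
    by (smt (verit) mult_nonneg_nonpos of_nat_0_le_iff rangeI)
  have "(h $ i)\<^sup>2 \<le> real (card ?S) * \<psi> (h $ i)" using lower by simp
  also have "\<dots> \<le> real CARD('n) * \<psi> (h $ i)"
    using \<open>0 \<le> \<psi> (h $ i)\<close> card_image_le[of UNIV "($) h"] by (intro mult_right_mono) auto
  also have "\<dots> \<le> real CARD('n) * (m $ i - (h $ i)\<^sup>2 + h $ i)"
    using psi_le by (intro mult_left_mono) auto
  finally show ?thesis .
qed

text \<open>Jensen's inequality, from the nonnegative variance of \<open>x\<close> under
  \<open>\<pi>\<close>.\<close>

lemma initial_square_le: "(\<pi> \<bullet> x)\<^sup>2 \<le> \<pi> \<bullet> (\<chi> i. (x $ i)\<^sup>2)"
proof -
  let ?\<mu> = "\<pi> \<bullet> x"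
  have "0 \<le> (\<Sum>i\<in>UNIV. \<pi> $ i * (x $ i - ?\<mu>)\<^sup>2)"
    using initial by (intro sum_nonneg) (simp add: probability_vector_def)
  also have "\<dots> = (\<Sum>i\<in>UNIV. \<pi> $ i * (x $ i)\<^sup>2) - 2 * ?\<mu> * (\<Sum>i\<in>UNIV. \<pi> $ i * x $ i)
      + ?\<mu>\<^sup>2 * (\<Sum>i\<in>UNIV. \<pi> $ i)"
    by (simp add: power2_diff algebra_simps sum.distrib sum_subtractf sum_distrib_left
        sum_distrib_right)
  also have "\<dots> = \<pi> \<bullet> (\<chi> i. (x $ i)\<^sup>2) - 2 * ?\<mu> * ?\<mu> + ?\<mu>\<^sup>2"
    using initial by (simp add: inner_vec_def probability_vector_def)
  finally show ?thesis by (simp add: power2_eq_square)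
qed

lemma variance_bound:
  obtains \<mu> m where "(\<lambda>n. real (Suc n) * hitting_prob n) sums \<mu>"
    "(\<lambda>n. (real (Suc n))\<^sup>2 * hitting_prob n) sums m"
    "\<mu> * (\<mu> - real CARD('n)) \<le> real CARD('n) * (m - \<mu>\<^sup>2)"
proof -
  let ?d = "real CARD('n)"
  obtain h where h: "h = 1 + A *v h" by (rule solve)
  obtain m where m: "m = (1 + 2 *\<^sub>R (A *v h)) + A *v m" by (rule solve)
  define h2 where "h2 = (\<chi> i. (h $ i)\<^sup>2)"
  have "h2 \<le> ?d *\<^sub>R (m - h2 + h)"
    using second_moment_lower_bound[OF h m] by (simp add: less_eq_vec_def h2_def)
  from initial_mono[OF this]
  have "(1 + ?d) * (\<pi> \<bullet> h2) \<le> ?d * (\<pi> \<bullet> m + \<pi> \<bullet> h)"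
    by (simp add: inner_diff_right inner_add_right algebra_simps)
  \<comment> \<open>The averaged bound has collected the squares with factor \<open>1 + d\<close>,
    so Jensen can replace their mean by the square of the mean.\<close>
  moreover have "(1 + ?d) * (\<pi> \<bullet> h)\<^sup>2 \<le> (1 + ?d) * (\<pi> \<bullet> h2)"
    using initial_square_le[of h] by (intro mult_left_mono) (auto simp: h2_def)
  ultimately have "(\<pi> \<bullet> h) * (\<pi> \<bullet> h - ?d) \<le> ?d * (\<pi> \<bullet> m - (\<pi> \<bullet> h)\<^sup>2)"
    by (simp add: power2_eq_square algebra_simps)
  then show ?thesis using that first_moment_sums[OF h] second_moment_sums[OF h m] by blast
qed

end

section \<open>First-tick times of counting processes\<close>

text \<open>The processes are compared through the law of the first tick, so \<open>A\<close> may
  differ from \<open>T0\<close>.\<close>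

lemma (in absorbed_process) tick_variance_bound:
  assumes "\<And>n. first_tick_prob \<pi> T0 T1 (Suc n) = hitting_prob n"
  shows "tick_mean \<pi> T0 T1 * (tick_mean \<pi> T0 T1 - real CARD('n))
    \<le> real CARD('n) * tick_variance \<pi> T0 T1"
proof -
  let ?p = "first_tick_prob \<pi> T0 T1"
  \<comment> \<open>Nonnegative terms turn a convergent series into an unconditional sum, and
    \<open>Suc\<close> restores the index \<open>L\<close>.\<close>
  have has_sum: "((\<lambda>L. f L * ?p L) has_sum s) {1..}"
    if "(\<lambda>n. f (Suc n) * hitting_prob n) sums s" "\<And>L. 0 \<le> f L" for f s
  proof -
    have "((\<lambda>n. f (Suc n) * hitting_prob n) has_sum s) UNIV"
      using that hitting_prob_nonneg by (intro sums_nonneg_imp_has_sum) auto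
    moreover have "bij_betw Suc UNIV {1..}"
      by (auto simp: bij_betw_def image_iff dest: Suc_le_D)
    ultimately show ?thesis
      using has_sum_reindex_bij_betw[of Suc UNIV "{1..}" "\<lambda>L. f L * ?p L" s] assms by simp
  qed
  obtain \<mu> m where \<mu>: "(\<lambda>n. real (Suc n) * hitting_prob n) sums \<mu>"
    and m: "(\<lambda>n. (real (Suc n))\<^sup>2 * hitting_prob n) sums m"
    and bound: "\<mu> * (\<mu> - real CARD('n)) \<le> real CARD('n) * (m - \<mu>\<^sup>2)"
    by (rule variance_bound)
  have mean: "tick_mean \<pi> T0 T1 = \<mu>"
    unfolding tick_mean_def by (intro infsumI has_sum \<mu>) auto
  have "(\<lambda>n. (real (Suc n))\<^sup>2 * hitting_prob n - 2 * \<mu> * (real (Suc n) * hitting_prob n)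
      + \<mu>\<^sup>2 * hitting_prob n) sums (m - 2 * \<mu> * \<mu> + \<mu>\<^sup>2 * 1)"
    by (intro sums_add sums_diff sums_mult m \<mu> hitting_prob_sums)
  then have "(\<lambda>n. (real (Suc n) - \<mu>)\<^sup>2 * hitting_prob n) sums (m - \<mu>\<^sup>2)"
    by (simp only: power2_eq_square ring_distribs mult_ac) (simp add: algebra_simps)
  then have "tick_variance \<pi> T0 T1 = m - \<mu>\<^sup>2"
    unfolding tick_variance_def mean
    by (intro infsumI has_sum) auto
  then show ?thesis using mean bound by simp
qed

lemma first_tick_prob_Suc:
  assumes "counting_process \<pi> T0 T1"
  shows "first_tick_prob \<pi> T0 T1 (Suc n) =
    (\<pi> v* matrix_power T0 n) \<bullet> 1 - (\<pi> v* matrix_power T0 (Suc n)) \<bullet> 1"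
proof -
  have "T1 *v 1 = 1 - T0 *v 1"
    using assms by (simp add: counting_process_def matrix_vector_mult_add_rdistrib algebra_simps)
  then show ?thesis
    by (simp add: first_tick_prob_def inner_diff_right dot_lmul_matrix matrix_vector_mul_assoc
        matrix_power_commute)
qed

text \<open>The tick probabilities telescope: their partial sums are one minus the survival
  probability.\<close>

lemma survival_tendsto_0:
  assumes "counting_process \<pi> T0 T1" "eventually_ticks \<pi> T0 T1"
  shows "(\<lambda>n. (\<pi> v* matrix_power T0 n) \<bullet> 1) \<longlonglongrightarrow> 0"
proof -
  have "bij_betw Suc UNIV {1..}"
    by (auto simp: bij_betw_def image_iff dest: Suc_le_D)
  then have "((\<lambda>n. first_tick_prob \<pi> T0 T1 (Suc n)) has_sum 1) UNIV"
    using assms(2) has_sum_reindex_bij_betw unfolding eventually_ticks_def by blast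
  then have "(\<lambda>n. first_tick_prob \<pi> T0 T1 (Suc n)) sums 1" by (rule has_sum_imp_sums)
  moreover have "(\<Sum>n<N. first_tick_prob \<pi> T0 T1 (Suc n)) = 1 - (\<pi> v* matrix_power T0 N) \<bullet> 1" for N
    unfolding first_tick_prob_Suc[OF assms(1)] sum_lessThan_telescope'[of "\<lambda>n. (\<pi> v* matrix_power T0 n) \<bullet> 1"]
    using assms(1) by (simp add: counting_process_def probability_vector_def inner_vec_def)
  ultimately have "(\<lambda>N. 1 - (\<pi> v* matrix_power T0 N) \<bullet> 1) \<longlonglongrightarrow> 1" by (simp add: sums_def)
  from tendsto_diff[OF tendsto_const[of 1] this] show ?thesis by simp
qed

theorem theorem1:
  fixes \<pi> :: "real^'n" and T0 T1 :: "real^'n^'n"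
  assumes "counting_process \<pi> T0 T1"
    and "eventually_ticks \<pi> T0 T1"
  shows "real CARD('n) * tick_variance \<pi> T0 T1
           \<ge> tick_mean \<pi> T0 T1 * (tick_mean \<pi> T0 T1 - real CARD('n))"
proof -
  let ?w = "\<lambda>n. \<pi> v* matrix_power T0 n"
  \<comment> \<open>Unreachable states may never tick, so their rows are cleared; this leaves all
    \<open>\<pi> T0\<^sup>n\<close> unchanged and makes the powers of the matrix tend to zero.\<close>
  define R where "R = {i. \<exists>n. ?w n $ i \<noteq> 0}"
  define A :: "real^'n^'n" where "A = (\<chi> i j. if i \<in> R then T0 $ i $ j else 0)"
  have initial: "probability_vector \<pi>" and T0: "nonneg_matrix T0" and T1: "nonneg_matrix T1"
    and stoch: "(T0 + T1) *v 1 = 1"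
    using assms(1) by (auto simp: counting_process_def)
  have A0: "nonneg_matrix A" using T0 by (simp add: nonneg_matrix_def A_def)
  have "(A *v 1) $ i \<le> 1" for i
  proof -
    have "(A *v 1) $ i \<le> ((T0 + T1) *v 1) $ i"
      using T0 T1 by (auto simp: A_def nonneg_matrix_def matrix_vector_mult_def intro!: sum_mono)
    then show ?thesis using stoch by simp
  qed
  then have A1: "A *v 1 \<le> 1" by (simp add: less_eq_vec_def)
  have w_nonneg: "0 \<le> ?w n $ i" for n i
    using initial nonneg_matrix_power[OF T0, of n]
    by (auto simp: probability_vector_def nonneg_matrix_def vector_matrix_mult_def intro!: sum_nonneg)
  have w_A: "?w n v* A = ?w (Suc n)" for n
  proof -
    \<comment> \<open>Cleared rows meet only zero entries of \<open>?w n\<close>.\<close>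
    have "?w n v* A = ?w n v* T0"
      by (auto simp: R_def A_def vec_eq_iff vector_matrix_mult_def intro!: sum.cong)
    then show ?thesis by (simp add: vector_matrix_mul_assoc matrix_power_commute)
  qed
  have w_eq: "?w m v* matrix_power A n = ?w (m + n)" for m n
  proof (induction n)
    case (Suc n)
    have "?w m v* matrix_power A (Suc n) = (?w m v* matrix_power A n) v* A"
      by (simp only: matrix_power.simps(2) vector_matrix_mul_assoc matrix_mul_assoc
          flip: matrix_power_commute)
    also have "\<dots> = ?w (m + Suc n)"
      unfolding Suc w_A by (simp only: add_Suc_right)
    finally show ?case .
  qed simp
  have A_nonneg: "0 \<le> (matrix_power A n *v 1) $ i" for n i
    using nonneg_matrix_mono[OF nonneg_matrix_power[OF A0], of 0 1 n]
    by (simp add: less_eq_vec_def)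
  have "(\<lambda>n. (matrix_power A n *v 1) $ i) \<longlonglongrightarrow> (0 :: real^'n) $ i" for i
  proof (cases "i \<in> R")
    case True
    then obtain m where m: "0 < ?w m $ i" using w_nonneg by (auto simp: R_def less_le)
    have "(matrix_power A n *v 1) $ i \<le> (?w (n + m) \<bullet> 1) / ?w m $ i" for n
    proof -
      \<comment> \<open>State \<open>i\<close> carries positive mass at some time \<open>m\<close>,
        so survival from \<open>i\<close> is at most the overall survival at time
        \<open>n + m\<close> divided by that mass.\<close>
      have "?w m $ i * (matrix_power A n *v 1) $ i \<le> ?w m \<bullet> (matrix_power A n *v 1)"
        unfolding inner_vec_def using w_nonneg A_nonneg
        by (simp add: member_le_sum[of i UNIV "\<lambda>i. ?w m $ i * (matrix_power A n *v 1) $ i"])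
      also have "\<dots> = ?w (n + m) \<bullet> 1" by (simp add: w_eq add.commute flip: dot_lmul_matrix)
      finally show ?thesis using m by (simp add: field_simps)
    qed
    then have "norm ((matrix_power A n *v 1) $ i) \<le> (?w (n + m) \<bullet> 1) / ?w m $ i" for n
      using A_nonneg by simp
    moreover have "(\<lambda>n. (?w (n + m) \<bullet> 1) / ?w m $ i) \<longlonglongrightarrow> 0"
      using LIMSEQ_ignore_initial_segment[OF survival_tendsto_0[OF assms]]
      by (rule tendsto_divide_zero)
    ultimately show ?thesis
      unfolding zero_index by (rule Lim_null_comparison[OF always_eventually[OF allI]])
  next
    case False
    \<comment> \<open>A cleared row means absorption after one step, so the sequence is zero from
      index \<open>1\<close> on.\<close>
    then have "(matrix_power A (Suc n) *v 1) $ i = 0" for n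
      unfolding matrix_power_vector_Suc by (simp add: A_def matrix_vector_mult_def)
    then show ?thesis by (subst filterlim_sequentially_Suc[symmetric]) simp
  qed
  then have "(\<lambda>n. matrix_power A n *v 1) \<longlonglongrightarrow> 0" by (rule vec_tendstoI)
  then interpret absorbed_process A \<pi>
    using A0 A1 initial by unfold_locales
  have "?w n \<bullet> 1 = survival n" for n
    using w_eq[of 0 n] by (simp add: survival_def flip: dot_lmul_matrix)
  then have "first_tick_prob \<pi> T0 T1 (Suc n) = hitting_prob n" for n
    unfolding first_tick_prob_Suc[OF assms(1)] hitting_prob_def by presburger
  then show ?thesis by (rule tick_variance_bound)
qed

end
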